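(* Let $k,n_1,\dots,n_k$ be positive integers. For each $i\in\{1,\dots,k\}$ let $\mathbb{R}^{n_i}$ be endowed with some norm $\|\cdot\|$ (possibly different for each $i$), let $|||\cdot|||$ be a norm on $\mathbb{R}^k$, and let $\mathbb{R}^{n_1+\cdots+n_k}=\mathbb{R}^{n_1}\times\cdots\times\mathbb{R}^{n_k}$ be endowed with the norm $\|(x_1,\dots,x_k)\| = |||(\|x_1\|,\dots,\|x_k\|)|||$. Suppose that for $i=1,\dots,k$ the sets $\mathcal{C}_i\subseteq\mathbb{R}^{n_i}$ are polytopes and $F_i\in\mathrm{faces}(\mathcal{C}_i)$. If the norm $|||\cdot|||$ on $\mathbb{R}^k$ is reasonable, then for $F:=F_1\times\cdots\times F_k$ and $\mathcal{C}:=\mathcal{C}_1\times\cdots\times\mathcal{C}_k$ it holds that $$\frac{1}{\Phi(F,\mathcal{C})} = \left|\left|\left|\left(\frac{1}{\Phi(F_1,\mathcal{C}_1)},\dots,\frac{1}{\Phi(F_k,\mathcal{C}_k)}\right)\right|\right|\right|^*,$$ where $|||\cdot|||^*$ is the dual norm of $|||\cdot|||$.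
   Context: A polytope is the convex hull of a finite set of points. For a polytope $\mathcal{C}$, $\mathrm{vert}(\mathcal{C})$ is its set of vertices and $\mathrm{faces}(\mathcal{C})$ is its set of nonempty faces (including $\mathcal{C}$ itself). For $G\in\mathrm{faces}(\mathcal{C})$ with $G\neq\mathcal{C}$, write $\mathcal{C}[G]:=\mathrm{conv}(\mathrm{vert}(\mathcal{C})\setminus G)$. For sets $S,T$ in a normed space, $\mathrm{dist}(S,T)=\min_{x\in S,\,y\in T}\|x-y\|$. For $F\in\mathrm{faces}(\mathcal{C})$, the facial distance from $F$ is $$\Phi(F,\mathcal{C}):=\min_{G\in\mathrm{faces}(F),\ G\subsetneq\mathcal{C}}\mathrm{dist}(G,\mathcal{C}[G]).$$ A norm $|||\cdot|||$ on $\mathbb{R}^k$ is called reasonable if $|||x|||\le|||y|||$ whenever $|x|\le|y|$ componentwise. The dual norm is $|||u|||^*:=\max\{\langle u,z\rangle : |||z|||\le 1\}$, with $\langle\cdot,\cdot\rangle$ the standard inner product. *)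

theory Defs
  imports "HOL-Analysis.Analysis"
begin

definition norm_on :: "'a::real_vector set \<Rightarrow> ('a \<Rightarrow> real) \<Rightarrow> bool" where
  "norm_on V N \<longleftrightarrow>
     (\<forall>x\<in>V. 0 \<le> N x) \<and>
     (\<forall>x\<in>V. N x = 0 \<longleftrightarrow> x = 0) \<and>
     (\<forall>c. \<forall>x\<in>V. N (c *\<^sub>R x) = \<bar>c\<bar> * N x) \<and>
     (\<forall>x\<in>V. \<forall>y\<in>V. N (x + y) \<le> N x + N y)"

definition reasonable :: "(real^'k \<Rightarrow> real) \<Rightarrow> bool" where
  "reasonable N \<longleftrightarrow> (\<forall>x y. (\<forall>i. \<bar>x $ i\<bar> \<le> \<bar>y $ i\<bar>) \<longrightarrow> N x \<le> N y)"

text \<open>For a norm \<open>N\<close> the supremum is a maximum, since the unit ball of \<open>N\<close> is compact.\<close>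

definition dual_norm :: "(real^'k \<Rightarrow> real) \<Rightarrow> real^'k \<Rightarrow> real" where
  "dual_norm N u = (SUP z\<in>{z. N z \<le> 1}. u \<bullet> z)"

definition vert :: "'a::real_vector set \<Rightarrow> 'a set" where
  "vert C = {x. x extreme_point_of C}"

definition faces :: "'a::real_vector set \<Rightarrow> 'a set set" where
  "faces C = {G. G face_of C \<and> G \<noteq> {}}"

definition opposite :: "'a::real_vector set \<Rightarrow> 'a set \<Rightarrow> 'a set" where
  "opposite C G = convex hull (vert C - G)"

text \<open>The library's \<^const>\<open>setdist\<close> is tied to the type class metric; here the norm is a parameter.
  For the nonempty compact sets to which it is applied below, the infimum is a minimum.\<close>

definition norm_setdist :: "('a::real_vector \<Rightarrow> real) \<Rightarrow> 'a set \<Rightarrow> 'a set \<Rightarrow> real" where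
  "norm_setdist N S T = (INF (x, y)\<in>S \<times> T. N (x - y))"

text \<open>The index set is empty exactly when \<open>C\<close> is a single point; the value is then \<open>\<infinity>\<close>,
  with reciprocal \<open>0\<close>. Otherwise it is a nonempty finite set, and the infimum is a minimum
  and a positive real. (Here \<open>C\<close> is a polytope and \<open>F\<close> a nonempty face of it.)\<close>

definition facial_distance :: "('a::real_vector \<Rightarrow> real) \<Rightarrow> 'a set \<Rightarrow> 'a set \<Rightarrow> ereal" where
  "facial_distance N F C =
     (INF G\<in>{G \<in> faces F. G \<subset> C}. ereal (norm_setdist N G (opposite C G)))"

text \<open>
  The product of Euclidean spaces of possibly different dimensions, indexed by \<open>'k\<close>, is
  \<^typ>\<open>real^'n\<close>, where the map \<open>b\<close> from \<open>'n\<close> to \<open>'k\<close> sends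
  each coordinate to the factor that it belongs to. The factor \<open>i\<close>, of dimension
  \<open>card {j. b j = i}\<close>, is identified with the subspace of vectors supported on \<open>{j. b j = i}\<close>,
  and the component \<open>x\<^sub>i\<close> of \<open>x\<close> with its coordinate projection to that subspace.
\<close>

definition factor :: "('n \<Rightarrow> 'k) \<Rightarrow> 'k \<Rightarrow> (real^'n) set" where
  "factor b i = {x. \<forall>j. b j \<noteq> i \<longrightarrow> x $ j = 0}"

definition component :: "('n \<Rightarrow> 'k) \<Rightarrow> 'k \<Rightarrow> real^'n \<Rightarrow> real^'n" where
  "component b i x = (\<chi> j. if b j = i then x $ j else 0)"

definition factor_product :: "('n \<Rightarrow> 'k) \<Rightarrow> ('k \<Rightarrow> (real^'n) set) \<Rightarrow> (real^'n) set" where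
  "factor_product b S = {x. \<forall>i. component b i x \<in> S i}"

definition product_norm ::
    "('n \<Rightarrow> 'k) \<Rightarrow> (real^'k \<Rightarrow> real) \<Rightarrow> ('k \<Rightarrow> real^'n \<Rightarrow> real) \<Rightarrow> real^'n \<Rightarrow> real" where
  "product_norm b N p x = N (\<chi> i. p i (component b i x))"

end

theory Submission
  imports Defs
begin

text \<open>
  Write \<open>W\<close> for the vector of reciprocals of the facial distances of the factors. The claim
  amounts to two estimates for the distance between a face of the product and its opposite.

  Lower bound. A vertex of the product lies outside a face \<open>G = G\<^sub>1 \<times> \<dots> \<times> G\<^sub>k\<close> as soon as one
  component lies outside \<open>G\<^sub>i\<close>. A point \<open>y\<close> of the opposite of \<open>G\<close> therefore has components \<open>y\<^sub>i\<close> with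
  weights \<open>l\<^sub>i\<close> on the opposites of the \<open>G\<^sub>i\<close>, and these weights add up to 1. Within one polytope,
  weight \<open>l\<close> on the opposite of a face forces a displacement of norm at least \<open>l\<close> times the facial distance
  (\<open>face_displacement\<close>, \<open>weight_le_reciprocal_facial_distance\<close>). For \<open>x\<close> in \<open>G\<close> this gives
  \<open>1 = \<Sum>i. l\<^sub>i \<le> \<Sum>i. W\<^sub>i * \<parallel>x\<^sub>i - y\<^sub>i\<parallel>\<close>, and the sum is at most the dual norm of \<open>W\<close> times the norm of \<open>x - y\<close>
  (\<open>product_separation\<close>).

  Upper bound. Given \<open>z\<close> in the unit ball of the norm on the index space, moving each
  component of a nearest pair by a share proportional to \<open>W\<^sub>i * \<bar>z\<^sub>i\<bar>\<close> yields points of a face and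
  of its opposite whose distance is at most the reciprocal of \<open>W \<bullet> z\<close> (\<open>product_near_pair\<close>).
  Taking the supremum over \<open>z\<close> gives the dual norm of \<open>W\<close>. That the norm is reasonable enters here,
  where a componentwise bound on displacements has to give a bound on the norm, and in the finiteness
  of the dual norm.

  The delicate point is the displacement estimate in one polytope. It holds for the minimum
  over all faces of \<open>F\<close> but not for a single one, and its proof passes to a smaller
  face by cancelling as much as possible from the displacement.
\<close>

section \<open>Norms on subspaces\<close>

lemma norm_on_zero: "norm_on V N \<Longrightarrow> 0 \<in> V \<Longrightarrow> N 0 = 0"
  by (auto simp: norm_on_def)

lemma norm_on_scale: "norm_on V N \<Longrightarrow> x \<in> V \<Longrightarrow> N (c *\<^sub>R x) = \<bar>c\<bar> * N x"
  by (auto simp: norm_on_def)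

lemma norm_on_nonneg: "norm_on V N \<Longrightarrow> x \<in> V \<Longrightarrow> 0 \<le> N x"
  by (auto simp: norm_on_def)

lemma norm_on_triangle: "norm_on V N \<Longrightarrow> x \<in> V \<Longrightarrow> y \<in> V \<Longrightarrow> N (x + y) \<le> N x + N y"
  by (auto simp: norm_on_def)

lemma norm_on_pos: "norm_on V N \<Longrightarrow> x \<in> V \<Longrightarrow> x \<noteq> 0 \<Longrightarrow> 0 < N x"
  unfolding norm_on_def by (simp add: order_less_le)

lemma norm_on_sum_le:
  assumes N: "norm_on V N" and V: "subspace V" and "finite B" "B \<subseteq> V"
  shows "N (\<Sum>b\<in>B. c b *\<^sub>R b) \<le> (\<Sum>b\<in>B. \<bar>c b\<bar> * N b)"
  using \<open>finite B\<close> \<open>B \<subseteq> V\<close>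
proof (induction B rule: finite_induct)
  case empty
  then show ?case using norm_on_zero[OF N subspace_0[OF V]] by simp
next
  case (insert a B)
  have "(\<Sum>b\<in>B. c b *\<^sub>R b) \<in> V"
    using insert V by (intro subspace_sum subspace_scale) auto
  then have "N (c a *\<^sub>R a + (\<Sum>b\<in>B. c b *\<^sub>R b)) \<le> N (c a *\<^sub>R a) + N (\<Sum>b\<in>B. c b *\<^sub>R b)"
    using insert V by (intro norm_on_triangle[OF N]) (auto intro: subspace_scale)
  then show ?case
    using insert norm_on_scale[OF N, of a "c a"] by auto
qed

text \<open>
  Expanding a vector in an orthonormal basis of the subspace bounds \<open>N\<close> by a multiple of the
  Euclidean norm, and the triangle inequality turns this bound into a Lipschitz estimate.
\<close>
lemma norm_on_continuous:
  fixes V :: "'a::euclidean_space set"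
  assumes N: "norm_on V N" and V: "subspace V"
  shows "continuous_on V N"
proof -
  have "\<exists>B. B \<subseteq> V \<and> pairwise orthogonal B \<and> (\<forall>x\<in>B. norm x = 1) \<and> independent B \<and> span B = V"
    by (rule orthonormal_basis_subspace[OF V]) blast
  then obtain B where B: "B \<subseteq> V" "pairwise orthogonal B" "\<And>x. x \<in> B \<Longrightarrow> norm x = 1"
      "independent B" "span B = V"
    by blast
  have fin: "finite B" by (rule independent_imp_finite[OF B(4)])
  define K where "K = (\<Sum>b\<in>B. N b)"
  have le: "N x \<le> K * norm x" if "x \<in> V" for x
  proof -
    have "x \<in> span B" using that B(5) by simp
    from orthonormal_basis_expand[OF B(2,3) this fin]
    have "N x = N (\<Sum>b\<in>B. (x \<bullet> b) *\<^sub>R b)" by simp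
    also have "\<dots> \<le> (\<Sum>b\<in>B. \<bar>x \<bullet> b\<bar> * N b)"
      by (rule norm_on_sum_le[OF N V fin B(1)])
    also have "\<dots> \<le> (\<Sum>b\<in>B. norm x * N b)"
    proof (intro sum_mono mult_right_mono)
      fix b assume b: "b \<in> B"
      show "\<bar>x \<bullet> b\<bar> \<le> norm x" using Cauchy_Schwarz_ineq2[of x b] B(3)[OF b] by simp
      show "0 \<le> N b" using norm_on_nonneg[OF N] B(1) b by blast
    qed
    finally show ?thesis by (simp add: K_def sum_distrib_left mult.commute)
  qed
  have K0: "K \<ge> 0" unfolding K_def using B(1) norm_on_nonneg[OF N] by (intro sum_nonneg) blast
  have half: "N x - N y \<le> K * norm (x - y)" if "x \<in> V" "y \<in> V" for x y
    using norm_on_triangle[OF N, of "x - y" y] le[of "x - y"] subspace_diff[OF V that] that by simp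
  have "K-lipschitz_on V N"
  proof (rule lipschitz_onI[OF _ K0])
    fix x y assume xy: "x \<in> V" "y \<in> V"
    show "dist (N x) (N y) \<le> K * dist x y"
      using half[of x y] half[of y x] xy by (auto simp: dist_norm norm_minus_commute abs_if)
  qed
  then show ?thesis by (rule lipschitz_on_continuous_on)
qed

section \<open>Faces of polytopes and their opposites\<close>

text \<open>
  A segment that meets the face \<open>G\<close> strictly between its endpoints has both endpoints in \<open>G\<close>.
  Consequently the opposite of a face is disjoint from that face.
\<close>
lemma convex_Diff_face:
  assumes "convex C" "G face_of C"
  shows "convex (C - G)"
  unfolding convex_contains_segment
proof (intro ballI subsetI DiffI)
  fix a b x assume ab: "a \<in> C - G" "b \<in> C - G" and x: "x \<in> closed_segment a b"
  show "x \<in> C" using ab x assms(1) by (meson DiffD1 convex_contains_segment subsetD)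
  show "x \<notin> G"
  proof
    assume "x \<in> G"
    then have "x \<in> open_segment a b" using ab x by (auto simp: open_segment_def)
    then show False using face_ofD[OF assms(2)] ab \<open>x \<in> G\<close> by blast
  qed
qed

lemma polytope_eq_hull_vert:
  fixes C :: "'a::euclidean_space set"
  shows "polytope C \<Longrightarrow> C = convex hull (vert C)"
  unfolding vert_def by (intro Krein_Milman_Minkowski polytope_imp_compact polytope_imp_convex)

lemma vert_subset: "vert C \<subseteq> C"
  by (auto simp: vert_def extreme_point_of_def)

lemma finite_vert: "polytope C \<Longrightarrow> finite (vert C)"
  unfolding vert_def polytope_def
  by (metis extreme_points_of_convex_hull finite_subset)

lemma opposite_disjoint:
  assumes "convex C" "G face_of C"
  shows "opposite C G \<subseteq> C - G"
  unfolding opposite_def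
  using vert_subset by (intro hull_minimal convex_Diff_face assms) auto

lemma compact_opposite:
  fixes C :: "'a::euclidean_space set"
  shows "polytope C \<Longrightarrow> compact (opposite C G)"
  unfolding opposite_def by (intro finite_imp_compact_convex_hull) (simp add: finite_vert)

lemma opposite_nonempty:
  fixes C :: "'a::euclidean_space set"
  assumes "polytope C" "convex G" "G \<subset> C"
  shows "opposite C G \<noteq> {}"
proof
  assume "opposite C G = {}"
  then have "convex hull (vert C) \<subseteq> G"
    using assms(2) by (intro hull_minimal) (auto simp: opposite_def)
  then show False using polytope_eq_hull_vert[OF assms(1)] assms(3) by simp
qed

text \<open>
  Continuity of the norm and compactness turn the infimum into a minimum. Together with the
  disjointness of a face and its opposite this is what makes facial distances positive.
\<close>
lemma norm_setdist_attained:
  fixes V :: "'a::euclidean_space set"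
  assumes N: "norm_on V N" and V: "subspace V"
    and S: "compact S" "S \<noteq> {}" "S \<subseteq> V" and T: "compact T" "T \<noteq> {}" "T \<subseteq> V"
  obtains x y where "x \<in> S" "y \<in> T" "norm_setdist N S T = N (x - y)"
    "\<And>x' y'. x' \<in> S \<Longrightarrow> y' \<in> T \<Longrightarrow> norm_setdist N S T \<le> N (x' - y')"
proof -
  have "fst q - snd q \<in> V" if "q \<in> S \<times> T" for q
    using that S T by (intro subspace_diff[OF V]) auto
  then have "(\<lambda>q. fst q - snd q) ` (S \<times> T) \<subseteq> V" by blast
  then have cont: "continuous_on (S \<times> T) (\<lambda>q. N (fst q - snd q))"
    by (rule continuous_on_compose2[OF norm_on_continuous[OF N V], rotated])
      (intro continuous_intros)
  have "compact (S \<times> T)" "S \<times> T \<noteq> {}" using S T compact_Times by auto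
  from continuous_attains_inf[OF this cont]
  obtain q where q: "q \<in> S \<times> T" "\<forall>r\<in>S \<times> T. N (fst q - snd q) \<le> N (fst r - snd r)"
    by blast
  have eq: "norm_setdist N S T = N (fst q - snd q)"
    unfolding norm_setdist_def case_prod_beta
    by (rule cInf_eq_minimum[OF imageI[OF q(1)]]) (use q(2) in auto)
  show ?thesis
  proof (rule that[OF _ _ eq])
    show "fst q \<in> S" "snd q \<in> T" using q(1) by auto
    show "norm_setdist N S T \<le> N (x' - y')" if "x' \<in> S" "y' \<in> T" for x' y'
      using bspec[OF q(2), of "(x', y')"] that eq by simp
  qed
qed

text \<open>
  The intersection of all faces through \<open>x\<close> works: if \<open>x\<close> were on its relative boundary, some
  facet of it would be a smaller face through \<open>x\<close>.
\<close>
lemma polytope_face_containing_rel_interior: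
  fixes C :: "'a::euclidean_space set"
  assumes C: "polytope C" and x: "x \<in> C"
  obtains G where "G face_of C" "x \<in> rel_interior G"
proof -
  define G where "G = \<Inter>{T. T face_of C \<and> x \<in> T}"
  have ne: "C \<in> {T. T face_of C \<and> x \<in> T}"
    using C x by (simp add: face_of_refl polytope_imp_convex)
  have G: "G face_of C" unfolding G_def using ne by (intro face_of_Inter) auto
  have xG: "x \<in> G" by (auto simp: G_def)
  have "x \<in> rel_interior G"
  proof (rule ccontr)
    assume "x \<notin> rel_interior G"
    moreover have "polyhedron G"
      using G C face_of_polytope_polytope polytope_imp_polyhedron by blast
    ultimately obtain H where H: "H facet_of G" "x \<in> H"
      using rel_interior_of_polyhedron xG by blast
    then have "H face_of C" using G facet_of_imp_face_of face_of_trans by blast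
    then have "G \<subseteq> H" using H(2) by (auto simp: G_def)
    then show False using H(1) facet_of_imp_subset facet_of_irrefl by fastforce
  qed
  then show ?thesis using that G by blast
qed

text \<open>
  The case \<open>a + b = 0\<close> is included on purpose: the mass that is rearranged in the minimality
  argument below may be exhausted completely.
\<close>
lemma convex_cone_combination:
  assumes "convex S" "v \<in> S" "w \<in> S" "0 \<le> a" "0 \<le> b"
  obtains s where "s \<in> S" "(a + b) *\<^sub>R s = a *\<^sub>R v + b *\<^sub>R w"
proof (cases "a + b = 0")
  case True
  then show ?thesis using that[of v] assms by (simp add: add_nonneg_eq_0_iff)
next
  case False
  have "(a / (a + b)) *\<^sub>R v + (b / (a + b)) *\<^sub>R w \<in> S"
    using assms False by (intro convexD) (auto simp: add_divide_distrib[symmetric])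
  then show ?thesis using that False by (force simp: scaleR_add_right)
qed

text \<open>
  Expand \<open>z\<close> in the vertices of \<open>C\<close>. If all vertices that occur lie outside \<open>G\<close>, then \<open>z\<close> belongs to the
  opposite of \<open>G\<close>; otherwise split off a vertex in \<open>G\<close> that occurs with positive weight.
\<close>
lemma not_in_opposite_obtains:
  fixes C :: "'a::euclidean_space set"
  assumes C: "polytope C" and z: "z \<in> C" "z \<notin> opposite C G"
  obtains v w \<mu> where "v \<in> G" "v \<in> C" "w \<in> C" "0 < \<mu>" "\<mu> \<le> 1" "z = \<mu> *\<^sub>R v + (1 - \<mu>) *\<^sub>R w"
proof -
  obtain u where "finite (vert C)" and u: "\<forall>v\<in>vert C. 0 \<le> u v" "sum u (vert C) = 1"
      "(\<Sum>v\<in>vert C. u v *\<^sub>R v) = z"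
  proof -
    have "z \<in> convex hull (vert C)" using z(1) polytope_eq_hull_vert[OF C] by simp
    then show ?thesis
      using that finite_vert[OF C] by (auto simp: convex_hull_finite)
  qed
  have "\<exists>v\<in>vert C \<inter> G. u v > 0"
  proof (rule ccontr)
    assume "\<not> ?thesis"
    then have 0: "\<forall>v\<in>vert C \<inter> G. u v = 0" using u(1) by force
    have "sum u (vert C - G) = sum u (vert C)"
        "(\<Sum>v\<in>vert C - G. u v *\<^sub>R v) = (\<Sum>v\<in>vert C. u v *\<^sub>R v)"
      using 0 \<open>finite (vert C)\<close> by (intro sum.mono_neutral_left; auto)+
    then have "sum u (vert C - G) = 1" "(\<Sum>v\<in>vert C - G. u v *\<^sub>R v) = z"
      using u by simp_all
    then have "z \<in> opposite C G"
      using u(1) \<open>finite (vert C)\<close> by (auto simp: opposite_def convex_hull_finite)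
    then show False using z by blast
  qed
  then obtain v where v: "v \<in> vert C" "v \<in> G" "u v > 0" by blast
  have split: "u v + sum u (vert C - {v}) = 1"
      "u v *\<^sub>R v + (\<Sum>a\<in>vert C - {v}. u a *\<^sub>R a) = z"
    using sum.remove[OF \<open>finite (vert C)\<close> v(1), of u] u(2)
      sum.remove[OF \<open>finite (vert C)\<close> v(1), of "\<lambda>a. u a *\<^sub>R a"] u(3) by simp_all
  have "0 \<le> sum u (vert C - {v})" using u(1) by (intro sum_nonneg) auto
  then have le: "u v \<le> 1" using split by linarith
  have vC: "v \<in> C" using v vert_subset by blast
  show ?thesis
  proof (cases "u v = 1")
    case True
    then have "\<forall>a\<in>vert C - {v}. u a = 0"
      using split(1) u(1) \<open>finite (vert C)\<close>
      by (subst sum_nonneg_eq_0_iff[symmetric]) auto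
    then have "z = v" using split(2) True by simp
    then show ?thesis using that[of v v 1] vC v by simp
  next
    case False
    define w where "w = (\<Sum>a\<in>vert C - {v}. (u a / (1 - u v)) *\<^sub>R a)"
    have "w \<in> C"
      unfolding w_def
      using False le u(1) \<open>finite (vert C)\<close> vert_subset[of C] split(1)
      by (intro convex_sum polytope_imp_convex C) (auto simp flip: sum_divide_distrib)
    moreover have "(1 - u v) *\<^sub>R w = (\<Sum>a\<in>vert C - {v}. u a *\<^sub>R a)"
      using False by (simp add: w_def scaleR_sum_right)
    ultimately show ?thesis using that[of v w "u v"] vC v le split by simp
  qed
qed

section \<open>Displacements between a face and its opposite\<close>

text \<open>
  A point \<open>y\<close> of \<open>C\<close> that carries weight \<open>l\<close> on the opposite of \<open>G\<close> should have
  distance at least \<open>l\<close> times a facial distance from every point \<open>x\<close> of \<open>G\<close>. For the pair of \<open>G\<close> and its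
  opposite alone this is false: let \<open>G\<close> be an edge of a triangle whose apex lies far to
  the side of it. One has to pass to a smaller face \<open>H\<close> of \<open>G\<close>.

  The displacement is written as \<open>x - y = t *\<^sub>R a - ((t - l) *\<^sub>R c + l *\<^sub>R u)\<close> with \<open>a\<close> in \<open>G\<close> and \<open>c\<close> in
  \<open>C\<close>, which is possible for \<open>t = 1\<close>. A representation with the least \<open>t \<ge> l\<close> exists by compactness,
  and in it nothing can be cancelled any more. If \<open>t > l\<close>, this means that \<open>c\<close> has no weight
  on the face \<open>H\<close> whose relative interior contains \<open>a\<close>: any such weight could be removed from
  both terms. Then \<open>c\<close> and \<open>u\<close> both lie in the opposite of \<open>H\<close>, and so does their
  average. If \<open>t = l\<close>, the point \<open>c\<close> has disappeared and \<open>H = G\<close> works.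
\<close>
lemma face_displacement:
  fixes C :: "'a::euclidean_space set"
  assumes C: "polytope C" and G: "G face_of C" and x: "x \<in> G" and u: "u \<in> opposite C G"
    and z: "z \<in> C" and l: "0 \<le> l" "l \<le> 1"
  obtains t H x' y' where "l \<le> t" "H face_of C" "H \<subseteq> G" "x' \<in> H" "y' \<in> opposite C H"
    "x - (l *\<^sub>R u + (1 - l) *\<^sub>R z) = t *\<^sub>R (x' - y')"
proof -
  define d where "d = x - (l *\<^sub>R u + (1 - l) *\<^sub>R z)"
  define R where "R = {(t, a, c). d = t *\<^sub>R a - (t - l) *\<^sub>R c - l *\<^sub>R u}"
  define T where "T = ({l..1} \<times> G \<times> C) \<inter> R"
  have cG: "compact G" "convex G"
    using face_of_imp_compact[OF _ _ G] face_of_imp_convex[OF G] C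
      polytope_imp_compact polytope_imp_convex by auto
  have "closed R"
    unfolding R_def case_prod_beta by (intro closed_Collect_eq continuous_intros)
  then have "compact T"
    unfolding T_def using cG polytope_imp_compact[OF C]
    by (intro compact_Int_closed compact_Times) auto
  moreover have "(1, x, z) \<in> T"
    using x z l by (auto simp: T_def R_def d_def algebra_simps)
  moreover have "continuous_on T fst" by (intro continuous_intros)
  ultimately obtain q where q0: "q \<in> T" "\<forall>r\<in>T. fst q \<le> fst r"
    using continuous_attains_inf[of T fst] by blast
  obtain t a c where qe: "q = (t, a, c)" by (rule prod_cases3)
  have q: "(t, a, c) \<in> T" using q0(1) qe by simp
  have min: "t \<le> t'" if "(t', a', c') \<in> T" for t' a' c'
    using bspec[OF q0(2) that] qe by simp
  have tac: "l \<le> t" "t \<le> 1" "a \<in> G" "c \<in> C" and d: "d = t *\<^sub>R a - (t - l) *\<^sub>R c - l *\<^sub>R u"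
    using q by (auto simp: T_def R_def)
  show ?thesis
  proof (cases "t = l")
    case True
    then show ?thesis using that[of l G a u] tac G u d by (simp add: d_def algebra_simps)
  next
    case False
    have "a \<in> C" using G tac face_of_imp_subset by blast
    obtain H where H: "H face_of C" "a \<in> rel_interior H"
      using polytope_face_containing_rel_interior[OF C \<open>a \<in> C\<close>] .
    have aH: "a \<in> H" using H(2) rel_interior_subset by blast
    have HG: "H \<subseteq> G"
      using subset_of_face_of[OF G face_of_imp_subset[OF H(1)]] H(2) tac(3) by blast
    have cH: "c \<in> opposite C H"
    proof (rule ccontr)
      assume "c \<notin> opposite C H"
      then obtain v w \<mu> where v: "v \<in> H" "w \<in> C" "0 < \<mu>" "\<mu> \<le> 1"
        and c: "c = \<mu> *\<^sub>R v + (1 - \<mu>) *\<^sub>R w"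
        using not_in_opposite_obtains[OF C tac(4)] by metis
      obtain e where e: "e > 1" "(1 - e) *\<^sub>R v + e *\<^sub>R a \<in> H"
        using convex_rel_interior_if2[OF face_of_imp_convex[OF H(1)] H(2)] v(1) hull_inc by metis
      \<comment> \<open>Since \<open>a\<close> is relatively interior to \<open>H\<close>, it carries positive weight on \<open>v\<close> as well.\<close>
      define b where "b = (1 - e) *\<^sub>R v + e *\<^sub>R a"
      have a: "a = (1 / e) *\<^sub>R b + (1 - 1 / e) *\<^sub>R v"
        using e by (simp add: b_def algebra_simps)
      \<comment> \<open>the multiple of \<open>v\<close> that is cancelled, as large as the weights on \<open>v\<close> permit\<close>
      define \<delta> where "\<delta> = min (t * (1 - 1 / e)) ((t - l) * \<mu>)"
      have tpos: "t > l" "t > 0" using False tac l by auto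
      have \<delta>: "0 < \<delta>" "\<delta> \<le> t * (1 - 1 / e)" "\<delta> \<le> (t - l) * \<mu>"
        using e tpos v by (auto simp: \<delta>_def)
      obtain a' where a': "a' \<in> H"
          "(t * (1 / e) + (t * (1 - 1 / e) - \<delta>)) *\<^sub>R a' = (t * (1 / e)) *\<^sub>R b + (t * (1 - 1 / e) - \<delta>) *\<^sub>R v"
        using convex_cone_combination[OF face_of_imp_convex[OF H(1)], of b v "t * (1 / e)" "t * (1 - 1 / e) - \<delta>"]
          e tpos \<delta> v b_def by auto
      have a'2: "(t - \<delta>) *\<^sub>R a' = t *\<^sub>R a - \<delta> *\<^sub>R v"
        using a'(2) by (simp add: a algebra_simps)
      obtain c' where c': "c' \<in> C"
          "(((t - l) * \<mu> - \<delta>) + (t - l) * (1 - \<mu>)) *\<^sub>R c' = ((t - l) * \<mu> - \<delta>) *\<^sub>R v + ((t - l) * (1 - \<mu>)) *\<^sub>R w"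
        using convex_cone_combination[OF polytope_imp_convex[OF C], of v w "(t - l) * \<mu> - \<delta>" "(t - l) * (1 - \<mu>)"]
          tpos \<delta> v face_of_imp_subset[OF H(1)] by auto
      have c'2: "(t - \<delta> - l) *\<^sub>R c' = (t - l) *\<^sub>R c - \<delta> *\<^sub>R v"
        using c'(2) by (simp add: c algebra_simps)
      have "(t - l) * \<mu> \<le> (t - l) * 1" using tpos v by (intro mult_left_mono) auto
      then have "\<delta> \<le> t - l" using order.trans[OF \<delta>(3)] by simp
      then have "(t - \<delta>, a', c') \<in> T"
        using a'(1) c'(1) HG tac \<delta> tpos a'2 c'2 by (auto simp: T_def R_def d)
      then show False using min \<delta>(1) by fastforce
    qed
    have uH: "u \<in> opposite C H"
      using u HG hull_mono[of "vert C - G" "vert C - H"] unfolding opposite_def by blast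
    have "t > l" "t > 0" using False tac l by auto
    then obtain y' where y': "y' \<in> opposite C H" "(t - l + l) *\<^sub>R y' = (t - l) *\<^sub>R c + l *\<^sub>R u"
      using convex_cone_combination[of "opposite C H" c u "t - l" l] cH uH l
      by (auto simp: opposite_def)
    have "t *\<^sub>R y' = (t - l) *\<^sub>R c + l *\<^sub>R u" using y'(2) by simp
    then have "d = t *\<^sub>R (a - y')" unfolding d scaleR_diff_right[of t a] by simp
    then show ?thesis using that[OF tac(1) H(1) HG aH y'(1)] by (simp add: d_def)
  qed
qed

section \<open>Facial distance of a polytope\<close>

text \<open>
  There are finitely many faces, so the infimum over them is attained as well; it is infinite
  exactly when there is no face to minimise over.
\<close>
lemma facial_distance_attained [consumes 5]:
  fixes V :: "'a::euclidean_space set"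
  assumes N: "norm_on V p" and V: "subspace V"
    and C: "polytope C" "C \<subseteq> V" and F: "F \<in> faces C"
  obtains (point) "facial_distance p F C = \<infinity>" "\<And>G. G \<in> faces F \<Longrightarrow> \<not> G \<subset> C"
  | (attained) d G x u where "facial_distance p F C = ereal d" "0 < d"
      "G \<in> faces F" "x \<in> G" "u \<in> opposite C G" "p (x - u) = d"
      "\<And>H y v. H \<in> faces F \<Longrightarrow> y \<in> H \<Longrightarrow> v \<in> opposite C H \<Longrightarrow> d \<le> p (y - v)"
proof -
  let ?I = "{G \<in> faces F. G \<subset> C}"
  let ?\<delta> = "\<lambda>G. norm_setdist p G (opposite C G)"
  have FC: "F face_of C" using F by (simp add: faces_def)
  have conv: "convex C" and comp: "compact C"
    using C polytope_imp_convex polytope_imp_compact by auto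
  have face: "G face_of C" if "G \<in> faces F" for G
    using that FC face_of_trans by (auto simp: faces_def)
  have dist: thesis' if G: "G \<in> ?I"
    and *: "\<And>x u. x \<in> G \<Longrightarrow> u \<in> opposite C G \<Longrightarrow> ?\<delta> G = p (x - u) \<Longrightarrow>
      (\<And>y v. y \<in> G \<Longrightarrow> v \<in> opposite C G \<Longrightarrow> ?\<delta> G \<le> p (y - v)) \<Longrightarrow> thesis'"
    for G thesis'
  proof -
    have Gf: "G face_of C" "G \<noteq> {}" "G \<subset> C" using G face by (auto simp: faces_def)
    have sub: "opposite C G \<subseteq> V" "G \<subseteq> V"
      using opposite_disjoint[OF conv Gf(1)] Gf(3) C(2) by auto
    show thesis'
      by (rule norm_setdist_attained[OF N V face_of_imp_compact[OF conv comp Gf(1)] Gf(2) sub(2)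
            compact_opposite[OF C(1)]
            opposite_nonempty[OF C(1) face_of_imp_convex[OF Gf(1)] Gf(3)] sub(1)])
        (rule *)
  qed
  show ?thesis
  proof (cases "?I = {}")
    case True
    then show ?thesis
      using point by (simp only: facial_distance_def INF_empty top_ereal_def) blast
  next
    case False
    have "finite ?I"
      by (rule finite_subset[OF _ finite_polytope_faces[OF C(1)]]) (use face in blast)
    then obtain G where G: "G \<in> ?I" "\<And>H. H \<in> ?I \<Longrightarrow> ?\<delta> G \<le> ?\<delta> H"
      using ex_min_if_finite[of "?\<delta> ` ?I"] False by (auto simp: not_less)
    have eq: "facial_distance p F C = ereal (?\<delta> G)"
      unfolding facial_distance_def
      by (intro antisym INF_lower[OF G(1)] INF_greatest) (use G(2) in simp)
    obtain x u where xu: "x \<in> G" "u \<in> opposite C G" "?\<delta> G = p (x - u)"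
      using dist[OF G(1)] by metis
    have Gf: "G face_of C" using G face by auto
    have "x \<noteq> u" using opposite_disjoint[OF conv Gf] xu by auto
    moreover have "x - u \<in> V"
      using xu opposite_disjoint[OF conv Gf] face_of_imp_subset[OF Gf] C(2)
      by (intro subspace_diff[OF V]) auto
    ultimately have pos: "0 < p (x - u)" using norm_on_pos[OF N] by simp
    have low: "p (x - u) \<le> p (y - v)" if H: "H \<in> faces F" and y: "y \<in> H" and v: "v \<in> opposite C H"
      for H y v
    proof -
      have Hf: "H face_of C" using H face by blast
      have "H \<noteq> C" using v opposite_disjoint[OF conv Hf] by auto
      then have HI: "H \<in> ?I" using H face_of_imp_subset[OF Hf] by auto
      have "?\<delta> G \<le> ?\<delta> H" using G(2) HI by simp
      also have "\<dots> \<le> p (y - v)" by (rule dist[OF HI]) (use y v in blast)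
      finally show ?thesis using xu by simp
    qed
    show ?thesis
      by (rule attained[OF _ pos _ xu(1,2) refl]) (use eq xu G low in auto)
  qed
qed

text \<open>
  The pairs of a weight \<open>l\<close> and a point with weight \<open>l\<close> on \<open>A\<close> and \<open>1 - l\<close> on \<open>B\<close> form a convex set.
  Recording the weight as an extra coordinate is what allows weights to be chosen consistently in several factors
  of a product by a single convexity argument.
\<close>
lemma graded_join_obtains [consumes 4]:
  fixes A B :: "'a::euclidean_space set"
  assumes "convex A" "convex B" "B \<noteq> {}" and l: "(l, y) \<in> convex hull ({1} \<times> A \<union> {0} \<times> B)"
  obtains (zero) "l = 0"
  | (join) u z where "u \<in> A" "z \<in> B" "0 \<le> l" "l \<le> 1" "y = l *\<^sub>R u + (1 - l) *\<^sub>R z"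
proof (cases "A = {}")
  case True
  then have "(l, y) \<in> {0} \<times> B"
    using l assms(2) by (simp add: convex_hull_Times hull_same)
  then show ?thesis using zero by simp
next
  case False
  have "convex ({1::real} \<times> A)" "convex ({0::real} \<times> B)"
    using assms by (auto intro: convex_Times)
  from convex_hull_union_two[OF this(1) _ this(2)]
  have "\<exists>q s t. 0 \<le> l \<and> 0 \<le> q \<and> l + q = 1 \<and> s \<in> A \<and> t \<in> B \<and> y = l *\<^sub>R s + q *\<^sub>R t"
    using l False assms(3) by auto
  then obtain q s t where q: "0 \<le> l" "0 \<le> q" "l + q = 1" "s \<in> A" "t \<in> B" "y = l *\<^sub>R s + q *\<^sub>R t"
    by blast
  have "q = 1 - l" using q(3) by simp
  then show ?thesis using join[of s t] q by simp
qed

text \<open>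
  For a polytope and one of its nonempty faces the facial distance is positive or infinite, so its
  reciprocal is a real number, which is 0 in the infinite case.
\<close>
definition reciprocal_facial_distance :: "('a::real_vector \<Rightarrow> real) \<Rightarrow> 'a set \<Rightarrow> 'a set \<Rightarrow> real" where
  "reciprocal_facial_distance p F C = real_of_ereal (1 / facial_distance p F C)"

text \<open>
  The face \<open>G\<close> and the point \<open>x\<close> are provided even if the reciprocal is 0, in order that every factor
  of a product can contribute a face.
\<close>
lemma reciprocal_facial_distance_attained:
  fixes V :: "'a::euclidean_space set"
  assumes N: "norm_on V p" and V: "subspace V"
    and C: "polytope C" "C \<subseteq> V" and F: "F \<in> faces C"
  defines "w \<equiv> reciprocal_facial_distance p F C"
  obtains G x u where "G \<in> faces F" "x \<in> G" "0 \<le> w"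
    "w \<noteq> 0 \<Longrightarrow> u \<in> opposite C G \<and> w * p (x - u) = 1"
using N V C F
proof (cases rule: facial_distance_attained)
  case point
  have "w = 0" using point by (simp add: w_def reciprocal_facial_distance_def)
  moreover have "F \<in> faces F" "F \<noteq> {}"
    using F face_of_imp_convex[of F C] by (auto simp: faces_def face_of_refl)
  ultimately show ?thesis using that by blast
next
  case (attained d G x u)
  then have "w = 1 / d"
    by (simp add: w_def reciprocal_facial_distance_def one_ereal_def)
  then show ?thesis using attained that[of G x u] by simp
qed

text \<open>
  By \<open>face_displacement\<close>, \<open>y\<close> may have weight on the opposite of \<open>G\<close> only in
  proportion to its distance from \<open>x\<close>.
\<close>
lemma weight_le_reciprocal_facial_distance:
  fixes V :: "'a::euclidean_space set"
  assumes N: "norm_on V p" and V: "subspace V"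
    and C: "polytope C" "C \<subseteq> V" and F: "F \<in> faces C"
    and G: "G \<in> faces F" and x: "x \<in> G" and y: "y \<in> C"
    and ly: "(l, y) \<in> convex hull ({1} \<times> opposite C G \<union> {0} \<times> C)"
  defines "w \<equiv> reciprocal_facial_distance p F C"
  shows "l \<le> w * p (x - y)"
proof -
  have conv: "convex C" using C polytope_imp_convex by auto
  have Gf: "G face_of C" using G F face_of_trans by (auto simp: faces_def)
  have xC: "x \<in> C" using face_of_imp_subset[OF Gf] x by blast
  have "x - y \<in> V" using xC y C by (intro subspace_diff[OF V]) auto
  then have p0: "0 \<le> p (x - y)" using norm_on_nonneg[OF N] by blast
  have w0: "0 \<le> w"
    using reciprocal_facial_distance_attained[OF N V C F] unfolding w_def by metis
  have "convex (opposite C G)" "C \<noteq> {}" using xC by (auto simp: opposite_def)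
  from this(1) conv this(2) ly show ?thesis
  proof (cases rule: graded_join_obtains)
    case zero
    then show ?thesis using p0 w0 by simp
  next
    case (join u z)
    obtain t H x' y' where t: "l \<le> t" "H face_of C" "H \<subseteq> G" "x' \<in> H" "y' \<in> opposite C H"
        "x - y = t *\<^sub>R (x' - y')"
      using face_displacement[OF C(1) Gf x join(1,2,3,4)] join(5) by metis
    have HF: "H \<in> faces F"
      using t G face_of_imp_subset[of G F] face_of_subset[OF t(2), of F] F face_of_imp_subset[of F C]
      by (auto simp: faces_def)
    have HC: "x' \<in> C" "y' \<in> C" "H \<subset> C"
      using t opposite_disjoint[OF conv t(2)] face_of_imp_subset[OF t(2)] by auto
    have V': "x' - y' \<in> V" using HC C by (intro subspace_diff[OF V]) auto
    from N V C F show ?thesis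
    proof (cases rule: facial_distance_attained)
      case point
      then show ?thesis using HF HC by blast
    next
      case (attained d)
      have w: "w = 1 / d"
        using attained(1,2) by (simp add: w_def reciprocal_facial_distance_def one_ereal_def)
      have "l * d \<le> t * p (x' - y')"
        using attained(2) attained(7)[OF HF t(4,5)] t(1) join(3) by (intro mult_mono) auto
      also have "\<dots> = p (x - y)"
        using norm_on_scale[OF N V', of t] t(1,6) join(3) by simp
      finally show ?thesis using attained(2) by (simp add: w field_simps)
    qed
  qed
qed

section \<open>The dual of a reasonable norm\<close>

text \<open>
  A reasonable norm controls each coordinate separately, because zeroing all other coordinates
  does not increase it.
\<close>
lemma inner_bdd_above_unit_ball:
  fixes u :: "real^'k"
  assumes N: "norm_on UNIV N" and r: "reasonable N"
  shows "bdd_above ((\<lambda>z. u \<bullet> z) ` {z. N z \<le> 1})"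
proof (rule bdd_aboveI2)
  fix z assume z: "z \<in> {z. N z \<le> 1}"
  have "u $ i * z $ i \<le> \<bar>u $ i\<bar> * (1 / N (axis i 1))" for i
  proof -
    have pos: "0 < N (axis i 1)" by (rule norm_on_pos[OF N]) (auto simp: axis_eq_0_iff)
    have "\<bar>z $ i\<bar> * N (axis i 1) = N (z $ i *\<^sub>R axis i 1)"
      using norm_on_scale[OF N] by simp
    also have "\<forall>j. \<bar>(z $ i *\<^sub>R axis i 1) $ j\<bar> \<le> \<bar>z $ j\<bar>" by (auto simp: axis_def)
    then have "N (z $ i *\<^sub>R axis i 1) \<le> N z" using r unfolding reasonable_def by blast
    finally have "\<bar>z $ i\<bar> \<le> 1 / N (axis i 1)" using z pos by (simp add: field_simps)
    then have "\<bar>u $ i\<bar> * \<bar>z $ i\<bar> \<le> \<bar>u $ i\<bar> * (1 / N (axis i 1))" by (intro mult_left_mono) auto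
    then show ?thesis by (metis abs_ge_self abs_mult order.trans)
  qed
  then show "u \<bullet> z \<le> (\<Sum>i\<in>UNIV. \<bar>u $ i\<bar> * (1 / N (axis i 1)))"
    unfolding inner_vec_def inner_real_def by (intro sum_mono)
qed

lemma inner_le_dual_norm:
  assumes N: "norm_on UNIV N" and r: "reasonable N"
  shows "u \<bullet> z \<le> dual_norm N u * N z"
proof (cases "z = 0")
  case True
  then show ?thesis using norm_on_zero[OF N] by simp
next
  case False
  have pos: "0 < N z" using norm_on_pos[OF N] False by simp
  have "N (z /\<^sub>R N z) = 1" using norm_on_scale[OF N, of z] pos by simp
  then have "u \<bullet> (z /\<^sub>R N z) \<le> dual_norm N u"
    unfolding dual_norm_def by (intro cSUP_upper inner_bdd_above_unit_ball N r) simp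
  then show ?thesis using pos by (simp add: field_simps)
qed

section \<open>Products and their faces\<close>

lemma component_nth [simp]: "component b i x $ j = (if b j = i then x $ j else 0)"
  by (simp add: component_def)

lemma linear_component: "linear (component b i)"
  by (auto intro!: linearI simp: vec_eq_iff)

lemmas component_add = linear_add[OF linear_component]
  and component_diff = linear_diff[OF linear_component]
  and component_scale = linear_scale[OF linear_component]
  and component_sum = linear_sum[OF linear_component]

lemma component_eqI: "(\<And>i. component b i x = component b i y) \<Longrightarrow> x = y"
  by (metis (no_types, lifting) component_nth vec_eq_iff)

lemma component_factor: "x \<in> factor b i \<Longrightarrow> component b j x = (if j = i then x else 0)"
  by (auto simp: factor_def vec_eq_iff)

lemma mem_factor_product: "x \<in> factor_product b S \<longleftrightarrow> (\<forall>i. component b i x \<in> S i)"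
  by (simp add: factor_product_def)

lemma component_in_factor: "component b i x \<in> factor b i"
  by (simp add: factor_def)

lemma subspace_factor: "subspace (factor b i)"
  by (auto simp: factor_def subspace_def)

lemma sum_component_factor:
  fixes b :: "'n::finite \<Rightarrow> 'k::finite"
  assumes "\<And>i. s i \<in> factor b i"
  shows "component b j (\<Sum>i\<in>UNIV. s i) = s j"
proof -
  have "component b j (\<Sum>i\<in>UNIV. s i) = (\<Sum>i\<in>UNIV. if j = i then s i else 0)"
    unfolding component_sum by (intro sum.cong refl component_factor assms)
  then show ?thesis by simp
qed

text \<open>
  A product of subsets of the factors is their Minkowski sum, so that convex hulls commute with
  products because they commute with sums.
\<close>
lemma factor_product_eq_sum:
  fixes b :: "'n::finite \<Rightarrow> 'k::finite"
  assumes "\<And>i. S i \<subseteq> factor b i"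
  shows "factor_product b S = (\<Sum>i\<in>UNIV. S i)"
proof -
  have "x \<in> factor_product b S \<longleftrightarrow> (\<exists>s. x = sum s UNIV \<and> (\<forall>i. s i \<in> S i))" for x
  proof
    assume x: "x \<in> factor_product b S"
    have "x = (\<Sum>i\<in>UNIV. component b i x)"
      by (rule component_eqI[of b]) (simp only: sum_component_factor[OF component_in_factor])
    then show "\<exists>s. x = sum s UNIV \<and> (\<forall>i. s i \<in> S i)"
      using x by (intro exI[of _ "\<lambda>i. component b i x"]) (auto simp: factor_product_def)
  next
    assume "\<exists>s. x = sum s UNIV \<and> (\<forall>i. s i \<in> S i)"
    then obtain s where s: "x = sum s UNIV" "\<And>i. s i \<in> S i" by blast
    have "s i \<in> factor b i" for i using s(2) assms by blast
    from sum_component_factor[of s b, OF this] show "x \<in> factor_product b S"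
      using s by (simp add: factor_product_def)
  qed
  then show ?thesis by (auto simp: set_sum_alt)
qed

lemma convex_hull_factor_product:
  fixes b :: "'n::finite \<Rightarrow> 'k::finite"
  assumes "\<And>i. S i \<subseteq> factor b i"
  shows "convex hull (factor_product b S) = factor_product b (\<lambda>i. convex hull (S i))"
proof -
  have "convex hull (S i) \<subseteq> factor b i" for i
    by (intro hull_minimal assms subspace_imp_convex subspace_factor)
  then show ?thesis
    by (simp only: factor_product_eq_sum[OF assms] factor_product_eq_sum convex_hull_set_sum)
qed

definition exchange :: "('n \<Rightarrow> 'k) \<Rightarrow> 'k set \<Rightarrow> real^'n \<Rightarrow> real^'n \<Rightarrow> real^'n" where
  "exchange b I x y = (\<chi> j. if b j \<in> I then x $ j else y $ j)"

lemma component_exchange [simp]: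
  "component b i (exchange b I x y) = (if i \<in> I then component b i x else component b i y)"
  by (auto simp: exchange_def vec_eq_iff)

lemma exchange_add: "exchange b I x y + exchange b I y x = x + y"
  by (auto simp: exchange_def vec_eq_iff)

text \<open>
  Exchanging components in both directions preserves the midpoint. A face that contains \<open>x\<close> and \<open>y\<close>
  contains their midpoint, hence the endpoints of every segment with this midpoint.
\<close>
lemma exchange_in_face:
  assumes G: "G face_of factor_product b S" and xy: "x \<in> G" "y \<in> G"
  shows "exchange b I x y \<in> G"
proof -
  let ?v = "exchange b I x y" and ?w = "exchange b I y x"
  have "x \<in> factor_product b S" "y \<in> factor_product b S"
    using face_of_imp_subset[OF G] xy by auto
  then have vw: "?v \<in> factor_product b S" "?w \<in> factor_product b S"
    by (auto simp: factor_product_def)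
  have "midpoint ?v ?w = midpoint x y" by (simp add: midpoint_def exchange_add)
  also have "\<dots> \<in> G"
    using face_of_imp_convex[OF G] xy midpoint_in_closed_segment convex_contains_segment by blast
  finally have m: "midpoint ?v ?w \<in> G" .
  show ?thesis
  proof (cases "?v = ?w")
    case True
    then show ?thesis using m by simp
  next
    case False
    then have "midpoint ?v ?w \<in> open_segment ?v ?w" by simp
    then show ?thesis using face_ofD[OF G _ vw m] by blast
  qed
qed

text \<open>
  Faces of a product are products: the components of \<open>v\<close> can be brought in one at a time by exchanges
  that do not leave the face.
\<close>
lemma mem_face_of_factor_product:
  fixes b :: "'n::finite \<Rightarrow> 'k::finite"
  assumes G: "G face_of factor_product b S" and v: "\<And>i. component b i v \<in> component b i ` G"
  shows "v \<in> G"
proof -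
  obtain g where g: "g \<in> G" using v by blast
  have "exchange b I v g \<in> G" if "finite I" for I
    using that
  proof (induction I rule: finite_induct)
    case empty
    have "exchange b {} v g = g" by (rule component_eqI[of b]) simp
    then show ?case using g by simp
  next
    case (insert i I)
    obtain h where h: "h \<in> G" "component b i v = component b i h" using v[of i] by blast
    have "exchange b (insert i I) v g = exchange b {i} h (exchange b I v g)"
      by (rule component_eqI[of b]) (simp add: h(2))
    then show ?case using exchange_in_face[OF G h(1) insert.IH, of "{i}"] by simp
  qed
  from this[of UNIV] have "exchange b UNIV v g \<in> G" by simp
  moreover have "exchange b UNIV v g = v" by (rule component_eqI[of b]) simp
  ultimately show ?thesis by simp
qed

text \<open>
  A segment in one factor is lifted to the product by keeping the remaining components of \<open>g\<close>.
\<close>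
lemma component_image_face:
  assumes G: "G face_of factor_product b S" and S: "S i \<subseteq> factor b i"
  shows "component b i ` G face_of S i"
  unfolding face_of_def
proof (intro conjI ballI impI)
  show "component b i ` G \<subseteq> S i"
    using face_of_imp_subset[OF G] by (auto simp: factor_product_def)
  show "convex (component b i ` G)"
    by (rule convex_linear_image[OF linear_component face_of_imp_convex[OF G]])
  fix a c x
  assume a: "a \<in> S i" and c: "c \<in> S i" and x: "x \<in> component b i ` G" "x \<in> open_segment a c"
  obtain g where g: "g \<in> G" "x = component b i g" using x by blast
  let ?a = "exchange b {i} a g" and ?c = "exchange b {i} c g"
  have comp: "component b i a = a" "component b i c = c"
    using a c S component_factor by (metis subsetD)+
  have mem: "?a \<in> factor_product b S" "?c \<in> factor_product b S"
    using a c g face_of_imp_subset[OF G] comp by (auto simp: factor_product_def)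
  obtain t where t: "a \<noteq> c" "0 < t" "t < 1" "x = (1 - t) *\<^sub>R a + t *\<^sub>R c"
    using x(2) by (auto simp: in_segment)
  have "g = (1 - t) *\<^sub>R ?a + t *\<^sub>R ?c"
    by (rule component_eqI[of b])
      (use comp t(4) g(2) in \<open>auto simp: component_add component_scale simp flip: scaleR_add_left\<close>)
  moreover have "component b i ?a \<noteq> component b i ?c" using comp t(1) by simp
  then have "?a \<noteq> ?c" by metis
  ultimately have "g \<in> open_segment ?a ?c" using t by (auto simp: in_segment)
  then have "?a \<in> G" "?c \<in> G" using face_ofD[OF G _ mem g(1)] by auto
  moreover have "a = component b i ?a" "c = component b i ?c" using comp by simp_all
  ultimately show "a \<in> component b i ` G" "c \<in> component b i ` G" by blast+
qed

lemma factor_product_face: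
  fixes b :: "'n::finite \<Rightarrow> 'k"
  assumes "\<And>i. G i face_of S i"
  shows "factor_product b G face_of factor_product b S"
  unfolding face_of_def
proof (intro conjI ballI impI)
  show "factor_product b G \<subseteq> factor_product b S"
    using face_of_imp_subset[OF assms] by (auto simp: factor_product_def)
  show "convex (factor_product b G)"
  proof (rule convexI)
    fix x y :: "real^'n" and u v :: real
    assume "x \<in> factor_product b G" "y \<in> factor_product b G" "0 \<le> u" "0 \<le> v" "u + v = 1"
    then show "u *\<^sub>R x + v *\<^sub>R y \<in> factor_product b G"
      using face_of_imp_convex[OF assms]
      by (auto simp: factor_product_def component_add component_scale intro: convexD)
  qed
  fix a c x
  assume a: "a \<in> factor_product b S" and c: "c \<in> factor_product b S"
    and x: "x \<in> factor_product b G" "x \<in> open_segment a c"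
  obtain t where t: "0 < t" "t < 1" "x = (1 - t) *\<^sub>R a + t *\<^sub>R c"
    using x(2) by (auto simp: in_segment)
  have "component b i a \<in> G i \<and> component b i c \<in> G i" for i
  proof (cases "component b i a = component b i c")
    case True
    then have "component b i x = component b i a"
      using t(3) by (simp add: component_add component_scale flip: scaleR_add_left)
    moreover have "component b i x \<in> G i" using x(1) by (simp add: factor_product_def)
    ultimately show ?thesis using True by simp
  next
    case False
    then have "component b i x \<in> open_segment (component b i a) (component b i c)"
      using t by (auto simp: in_segment component_add component_scale)
    then show ?thesis
      using face_ofD[OF assms] a c x(1) by (auto simp: factor_product_def)
  qed
  then show "a \<in> factor_product b G" "c \<in> factor_product b G"
    by (auto simp: factor_product_def)
qed

text \<open>
  Vertices are the singleton faces, so both inclusions are instances of the facts on faces.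
\<close>
lemma vert_factor_product:
  assumes "\<And>i. S i \<subseteq> factor b i"
  shows "vert (factor_product b S) = factor_product b (\<lambda>i. vert (S i))"
proof -
  have "v \<in> vert (factor_product b S) \<longleftrightarrow> (\<forall>i. component b i v \<in> vert (S i))" for v
  proof
    assume "v \<in> vert (factor_product b S)"
    then have "{v} face_of factor_product b S" by (simp add: vert_def face_of_singleton)
    from component_image_face[OF this assms]
    show "\<forall>i. component b i v \<in> vert (S i)" by (simp add: vert_def face_of_singleton)
  next
    assume "\<forall>i. component b i v \<in> vert (S i)"
    then have "{component b i v} face_of S i" for i by (simp add: vert_def face_of_singleton)
    then have "factor_product b (\<lambda>i. {component b i v}) face_of factor_product b S"
      by (rule factor_product_face)
    moreover have "factor_product b (\<lambda>i. {component b i v}) = {v}"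
      by (auto simp: factor_product_def intro: component_eqI[of b])
    ultimately show "v \<in> vert (factor_product b S)" by (simp add: vert_def face_of_singleton)
  qed
  then show ?thesis by (auto simp: factor_product_def)
qed

lemma polytope_factor_product:
  fixes b :: "'n::finite \<Rightarrow> 'k::finite"
  assumes "\<And>i. C i \<subseteq> factor b i" and C: "\<And>i. polytope (C i)"
  shows "polytope (factor_product b C)"
proof -
  have sub: "vert (C i) \<subseteq> factor b i" for i using assms(1) vert_subset by blast
  have "finite (factor_product b (\<lambda>i. vert (C i)))"
    using finite_vert[OF C] by (simp add: factor_product_eq_sum[OF sub] finite_set_sum)
  moreover have "factor_product b C = convex hull (factor_product b (\<lambda>i. vert (C i)))"
    by (simp only: convex_hull_factor_product[OF sub] flip: polytope_eq_hull_vert[OF C])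
  ultimately show ?thesis unfolding polytope_def by blast
qed

section \<open>Facial distance of a product\<close>

lemma product_norm_nonneg:
  assumes "norm_on UNIV N"
  shows "0 \<le> product_norm b N p x"
  using norm_on_nonneg[OF assms] by (simp add: product_norm_def)

lemma norm_setdist_le:
  assumes "\<And>v. 0 \<le> N v" "x \<in> S" "y \<in> T"
  shows "norm_setdist N S T \<le> N (x - y)"
proof -
  have "bdd_below ((\<lambda>q. N (fst q - snd q)) ` (S \<times> T))"
    using assms(1) by (intro bdd_belowI2[of _ 0])
  from cINF_lower[OF this, of "(x, y)"] show ?thesis
    using assms(2,3) by (simp add: norm_setdist_def case_prod_beta)
qed

context
  fixes b :: "'n::finite \<Rightarrow> 'k::finite"
    and p :: "'k \<Rightarrow> real^'n \<Rightarrow> real"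
    and N :: "real^'k \<Rightarrow> real"
    and C F :: "'k \<Rightarrow> (real^'n) set"
    and W :: "real^'k"
  assumes p: "\<And>i. norm_on (factor b i) (p i)"
    and N: "norm_on UNIV N" and rN: "reasonable N"
    and CV: "\<And>i. C i \<subseteq> factor b i" and C: "\<And>i. polytope (C i)"
    and F: "\<And>i. F i \<in> faces (C i)"
  defines "W \<equiv> \<chi> i. reciprocal_facial_distance (p i) (F i) (C i)"
begin

lemma faces_product_face_of:
  assumes "G \<in> faces (factor_product b F)"
  shows "G face_of factor_product b C"
proof -
  have "factor_product b F face_of factor_product b C"
    using F by (intro factor_product_face) (simp add: faces_def)
  then show ?thesis using assms face_of_trans by (auto simp: faces_def)
qed

text \<open>
  The estimate that bounds the facial distance of the product from below. A vertex of the product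
  outside \<open>G\<close> leaves \<open>G\<close> in at least one factor. Hence \<open>y\<close>, an average of such vertices, distributes
  a total weight of 1 over the factors, the share \<open>l i\<close> being the weight of its \<open>i\<close>-th
  component on the opposite of the \<open>i\<close>-th component of \<open>G\<close>. Each share is at most \<open>W $ i\<close>
  times the displacement in its factor, and the sum of these bounds is an inner product with \<open>W\<close>.
\<close>
lemma product_separation:
  assumes G: "G \<in> faces (factor_product b F)" and x: "x \<in> G"
    and y: "y \<in> opposite (factor_product b C) G"
  shows "1 \<le> dual_norm N W * product_norm b N p (x - y)"
proof -
  define H where "H i = component b i ` G" for i
  define K where "K i = convex hull ({1::real} \<times> opposite (C i) (H i) \<union> {0} \<times> C i)" for i
  have FV: "F i \<subseteq> factor b i" for i
    using F CV face_of_imp_subset by (fastforce simp: faces_def)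
  have Gf: "G face_of factor_product b F" using G by (simp add: faces_def)
  have H: "H i \<in> faces (F i)" for i
    using component_image_face[OF Gf FV] G by (auto simp: faces_def H_def)
  \<comment> \<open>the points whose components have weights on the opposites of \<open>H i\<close> that add up to 1\<close>
  define Y where "Y = {y. \<exists>l. (\<Sum>i\<in>UNIV. l i) = 1 \<and> (\<forall>i. (l i, component b i y) \<in> K i)}"
  have "vert (factor_product b C) - G \<subseteq> Y"
  proof
    fix v assume v: "v \<in> vert (factor_product b C) - G"
    then have vi: "component b i v \<in> vert (C i)" for i
      by (simp add: vert_factor_product[OF CV] mem_factor_product)
    obtain k where k: "component b k v \<notin> H k"
      using mem_face_of_factor_product[OF Gf, of v] v unfolding H_def by blast
    have "(if i = k then 1 else 0, component b i v) \<in> K i" for i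
    proof -
      have "component b i v \<in> C i" using vi vert_subset by blast
      moreover have "component b k v \<in> opposite (C k) (H k)"
        unfolding opposite_def using vi k by (intro hull_inc) simp
      ultimately show ?thesis unfolding K_def by (intro hull_inc) auto
    qed
    then show "v \<in> Y"
      unfolding Y_def by (intro CollectI exI[of _ "\<lambda>i. if i = k then 1 else 0"]) simp
  qed
  moreover have "convex Y"
  proof (rule convexI)
    fix a c :: "real^'n" and s t :: real
    assume a: "a \<in> Y" and c: "c \<in> Y" and st: "0 \<le> s" "0 \<le> t" "s + t = 1"
    obtain l where l: "(\<Sum>i\<in>UNIV. l i) = 1" "\<And>i. (l i, component b i a) \<in> K i"
      using a by (auto simp: Y_def)
    obtain m where m: "(\<Sum>i\<in>UNIV. m i) = 1" "\<And>i. (m i, component b i c) \<in> K i"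
      using c by (auto simp: Y_def)
    have "s *\<^sub>R (l i, component b i a) + t *\<^sub>R (m i, component b i c) \<in> K i" for i
      unfolding K_def by (intro convexD convex_convex_hull st l(2)[unfolded K_def] m(2)[unfolded K_def])
    moreover have "(\<Sum>i\<in>UNIV. s * l i + t * m i) = 1"
      using l(1) m(1) st by (simp add: sum.distrib flip: sum_distrib_left)
    ultimately show "s *\<^sub>R a + t *\<^sub>R c \<in> Y"
      unfolding Y_def
      by (intro CollectI exI[of _ "\<lambda>i. s * l i + t * m i"]) (simp add: component_add component_scale)
  qed
  ultimately have "opposite (factor_product b C) G \<subseteq> Y"
    unfolding opposite_def by (rule hull_minimal)
  then obtain l where l: "(\<Sum>i\<in>UNIV. l i) = 1" "\<And>i. (l i, component b i y) \<in> K i"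
    using y by (auto simp: Y_def)
  have "convex (factor_product b C)"
    by (rule polytope_imp_convex[OF polytope_factor_product[OF CV C]])
  then have "y \<in> factor_product b C"
    using opposite_disjoint[OF _ faces_product_face_of[OF G]] y by blast
  then have yC: "component b i y \<in> C i" for i by (simp add: factor_product_def)
  have "l i \<le> W $ i * p i (component b i (x - y))" for i
    using weight_le_reciprocal_facial_distance[OF p subspace_factor C CV F H _ yC
        l(2)[unfolded K_def], of "component b i x"] x
    by (simp add: W_def H_def component_diff)
  then have "1 \<le> (\<Sum>i\<in>UNIV. W $ i * p i (component b i (x - y)))"
    unfolding l(1)[symmetric] by (intro sum_mono)
  also have "\<dots> = W \<bullet> (\<chi> i. p i (component b i (x - y)))"
    by (simp add: inner_vec_def)
  also have "\<dots> \<le> dual_norm N W * product_norm b N p (x - y)"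
    unfolding product_norm_def by (rule inner_le_dual_norm[OF N rN])
  finally show ?thesis .
qed

text \<open>
  The estimate that bounds the facial distance of the product from above. Take optimal faces and
  points in each factor, let \<open>x\<close> have the components \<open>x i\<close>, and let \<open>y\<close> be the average, with weights \<open>l i\<close>,
  of the points obtained from \<open>x\<close> by moving only the \<open>i\<close>-th component to a nearest point \<open>u i\<close> of the
  opposite of its face. Weights proportional to \<open>W $ i * \<bar>z $ i\<bar>\<close> make the displacement in the \<open>i\<close>-th factor
  at most proportional to \<open>\<bar>z $ i\<bar>\<close>, so that \<open>N z \<le> 1\<close> bounds its norm.
\<close>
lemma product_near_pair:
  assumes z: "N z \<le> 1" and pos: "0 < W \<bullet> z"
  obtains G x y where "G \<in> faces (factor_product b F)" "x \<in> G"
    "y \<in> opposite (factor_product b C) G" "(W \<bullet> z) * product_norm b N p (x - y) \<le> 1"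
proof -
  have "\<exists>G x u. G \<in> faces (F i) \<and> x \<in> G \<and> 0 \<le> W $ i \<and>
      (W $ i \<noteq> 0 \<longrightarrow> u \<in> opposite (C i) G \<and> W $ i * p i (x - u) = 1)" for i
    by (rule reciprocal_facial_distance_attained[OF p subspace_factor C CV F, of i])
      (auto simp: W_def)
  then obtain G x u where G: "\<And>i. G i \<in> faces (F i)" and x: "\<And>i. x i \<in> G i"
    and W0: "\<And>i. 0 \<le> W $ i"
    and u: "\<And>i. W $ i \<noteq> 0 \<Longrightarrow> u i \<in> opposite (C i) (G i)"
    and dist: "\<And>i. W $ i \<noteq> 0 \<Longrightarrow> W $ i * p i (x i - u i) = 1"
    by metis
  have Gf: "G i face_of F i" "G i face_of C i" for i
    using G[of i] F[of i] face_of_trans by (auto simp: faces_def)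
  have GV: "G i \<subseteq> factor b i" for i using face_of_imp_subset[OF Gf(2)] CV by blast
  have xV: "x i \<in> factor b i" and xC: "x i \<in> C i" for i
    using x GV face_of_imp_subset[OF Gf(2)] by blast+
  have uV: "u i \<in> factor b i" if "W $ i \<noteq> 0" for i
    using u[OF that] opposite_disjoint[OF polytope_imp_convex[OF C] Gf(2)] CV by blast
  define q where "q = (\<Sum>i\<in>UNIV. W $ i * \<bar>z $ i\<bar>)"
  \<comment> \<open>A factor with \<open>W $ i = 0\<close> has no nearest pair; it gets weight 0 and is left out of \<open>J\<close>.\<close>
  define l where "l i = W $ i * \<bar>z $ i\<bar> / q" for i
  define J where "J = {i. W $ i \<noteq> 0}"
  have "W \<bullet> z \<le> q"
    unfolding q_def inner_vec_def inner_real_def using W0 by (intro sum_mono mult_left_mono) auto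
  then have q: "0 < q" "W \<bullet> z \<le> q" using pos by auto
  have l0: "0 \<le> l i" "i \<notin> J \<Longrightarrow> l i = 0" for i using W0 q by (auto simp: l_def J_def)
  have "(\<Sum>i\<in>J. l i) = (\<Sum>i\<in>UNIV. l i)" by (intro sum.mono_neutral_left) (auto simp: l0)
  also have "\<dots> = 1" using q by (simp add: l_def q_def flip: sum_divide_distrib)
  finally have l1: "(\<Sum>i\<in>J. l i) = 1" .
  define X where "X = (\<Sum>i\<in>UNIV. x i)"
  define G' where "G' = factor_product b G"
  define V where "V i = X + (u i - x i)" for i
  define Y where "Y = (\<Sum>i\<in>J. l i *\<^sub>R V i)"
  have X: "component b i X = x i" for i unfolding X_def by (rule sum_component_factor[OF xV])
  have XG: "X \<in> G'" using x by (simp add: G'_def factor_product_def X)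
  have G': "G' \<in> faces (factor_product b F)"
    using factor_product_face[of G F b] Gf(1) XG by (auto simp: faces_def G'_def)
  have V: "V i \<in> opposite (factor_product b C) G'" if i: "i \<in> J" for i
  proof -
    \<comment> \<open>Only the \<open>i\<close>-th component has to avoid its face for a vertex to be outside the product face.\<close>
    define S where "S j = (if j = i then vert (C i) - G i else vert (C j))" for j
    have SV: "S j \<subseteq> factor b j" for j
      using vert_subset CV by (fastforce simp: S_def split: if_splits)
    have "component b j (V i) \<in> convex hull (S j)" for j
    proof (cases "j = i")
      case True
      then have "component b j (V i) = u i"
        using uV[of i] xV[of i] i by (simp add: V_def component_add component_diff X J_def component_factor)
      then show ?thesis using u[of i] i True by (simp add: S_def opposite_def J_def)
    next
      case False
      then have "component b j (V i) = x j"
        using uV[of i] xV[of i] i by (simp add: V_def component_add component_diff X J_def component_factor)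
      then show ?thesis
        using xC[of j] polytope_eq_hull_vert[OF C[of j]] False by (simp add: S_def)
    qed
    then have "V i \<in> convex hull (factor_product b S)"
      by (simp add: convex_hull_factor_product[OF SV]) (simp add: factor_product_def)
    moreover have "factor_product b S \<subseteq> vert (factor_product b C) - G'"
    proof
      fix v assume v: "v \<in> factor_product b S"
      then have "component b j v \<in> S j" for j by (simp add: factor_product_def)
      then have "component b j v \<in> vert (C j)" "component b i v \<notin> G i" for j
        unfolding S_def by (metis DiffD1, metis DiffD2)
      then show "v \<in> vert (factor_product b C) - G'"
        by (auto simp: vert_factor_product[OF CV] G'_def mem_factor_product)
    qed
    ultimately show ?thesis unfolding opposite_def using hull_mono by blast
  qed
  have Y: "Y \<in> opposite (factor_product b C) G'"
    unfolding Y_def by (intro convex_sum l1 l0 V) (auto simp: opposite_def)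
  define s where "s i = l i *\<^sub>R (x i - u i)" for i
  have sV: "s i \<in> factor b i" for i
  proof (cases "i \<in> J")
    case True
    then show ?thesis
      unfolding s_def using xV uV
      by (intro subspace_scale[OF subspace_factor] subspace_diff[OF subspace_factor]) (auto simp: J_def)
  next
    case False
    then show ?thesis by (simp add: s_def l0 subspace_0[OF subspace_factor])
  qed
  \<comment> \<open>Each \<open>V i\<close> differs from \<open>X\<close> in a single factor, so the displacement splits into the \<open>s i\<close>.\<close>
  have "X - Y = (\<Sum>i\<in>J. l i *\<^sub>R X) - Y" using l1 by (simp flip: scaleR_sum_left)
  also have "\<dots> = (\<Sum>i\<in>J. s i)"
    by (simp add: Y_def s_def V_def algebra_simps flip: sum_subtractf)
  also have "\<dots> = (\<Sum>i\<in>UNIV. s i)"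
    by (intro sum.mono_neutral_left) (auto simp: s_def l0)
  finally have XY: "component b i (X - Y) = s i" for i using sum_component_factor[OF sV] by simp
  have ps: "0 \<le> p i (s i)" "p i (s i) \<le> \<bar>z $ i\<bar> / q" for i
  proof -
    show "0 \<le> p i (s i)" using norm_on_nonneg[OF p sV] .
    show "p i (s i) \<le> \<bar>z $ i\<bar> / q"
    proof (cases "i \<in> J")
      case True
      have "p i (s i) = l i * p i (x i - u i)"
        unfolding s_def using norm_on_scale[OF p subspace_diff[OF subspace_factor xV uV], of i "l i"]
          True l0 by (simp add: J_def)
      also have "\<dots> = (W $ i * p i (x i - u i)) * \<bar>z $ i\<bar> / q" by (simp add: l_def)
      finally show ?thesis using dist[of i] True by (simp add: J_def)
    next
      case False
      then show ?thesis
        using q norm_on_zero[OF p subspace_0[OF subspace_factor]] by (simp add: s_def l0)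
    qed
  qed
  have "product_norm b N p (X - Y) = N (\<chi> i. p i (s i))" by (simp add: product_norm_def XY)
  also have "\<dots> \<le> N ((1 / q) *\<^sub>R z)"
    using rN[unfolded reasonable_def, rule_format, of "\<chi> i. p i (s i)" "(1 / q) *\<^sub>R z"] ps q
    by (simp add: abs_mult)
  also have "\<dots> \<le> 1 / q" using norm_on_scale[OF N, of z "1 / q"] z q by (simp add: divide_right_mono)
  finally have le: "product_norm b N p (X - Y) \<le> 1 / q" .
  have "(W \<bullet> z) * product_norm b N p (X - Y) \<le> q * (1 / q)"
    using q pos le product_norm_nonneg[OF N] by (intro mult_mono) auto
  then show ?thesis using that[OF G' XG Y] q by simp
qed

text \<open>
  When there is no face to minimise over, both sides vanish, since by
  \<open>product_near_pair\<close> a positive value of \<open>W \<bullet> z\<close> on the unit ball would yield such a face.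
  Otherwise both sides are positive reals that bound each other.
\<close>
lemma reciprocal_facial_distance_product:
  "1 / facial_distance (product_norm b N p) (factor_product b F) (factor_product b C) =
    ereal (dual_norm N W)"
proof -
  let ?F = "factor_product b F" and ?C = "factor_product b C" and ?n = "product_norm b N p"
  let ?I = "{G \<in> faces ?F. G \<subset> ?C}" and ?D = "dual_norm N W"
  let ?\<Phi> = "facial_distance ?n ?F ?C"
  have poly: "polytope ?C" by (rule polytope_factor_product[OF CV C])
  have n0: "0 \<le> ?n v" for v by (rule product_norm_nonneg[OF N])
  have proper: "G \<in> ?I" if "G \<in> faces ?F" "y \<in> opposite ?C G" for G y
    using opposite_disjoint[OF polytope_imp_convex[OF poly] faces_product_face_of[OF that(1)]]
      face_of_imp_subset[OF faces_product_face_of[OF that(1)]] that by auto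
  have ball: "{z. N z \<le> 1} \<noteq> {}" using norm_on_zero[OF N] by (auto intro: exI[of _ 0])
  have D0: "0 \<le> ?D"
    using cSUP_upper[OF _ inner_bdd_above_unit_ball[OF N rN], of 0 W] norm_on_zero[OF N]
    by (simp add: dual_norm_def)
  show ?thesis
  proof (cases "?I = {}")
    case True
    have "?D \<le> 0"
      unfolding dual_norm_def
    proof (rule cSUP_least[OF ball])
      fix z assume "z \<in> {z. N z \<le> 1}"
      then show "W \<bullet> z \<le> 0"
        using product_near_pair[of z] proper True by (metis empty_iff linorder_not_le mem_Collect_eq)
    qed
    moreover have "?\<Phi> = \<infinity>"
      unfolding facial_distance_def True by (simp add: top_ereal_def)
    ultimately show ?thesis using D0 by (simp add: zero_ereal_def)
  next
    case False
    have low: "1 / ?D \<le> norm_setdist ?n G (opposite ?C G)" and Dpos: "0 < ?D" if G: "G \<in> ?I" for G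
    proof -
      have ne: "G \<noteq> {}" "opposite ?C G \<noteq> {}"
        using G opposite_nonempty[OF poly face_of_imp_convex[OF faces_product_face_of]]
        by (auto simp: faces_def)
      have sep: "1 \<le> ?D * ?n (x - y)" if "x \<in> G" "y \<in> opposite ?C G" for x y
        using product_separation[of G x y] G that by simp
      show D: "0 < ?D" using sep ne D0 by (metis all_not_in_conv mult_zero_left not_one_le_zero order_less_le)
      show "1 / ?D \<le> norm_setdist ?n G (opposite ?C G)"
        unfolding norm_setdist_def case_prod_beta
        using ne sep D by (intro cINF_greatest) (auto simp: field_simps)
    qed
    obtain G0 where G0: "G0 \<in> ?I" using False by blast
    have "ereal (1 / ?D) \<le> ?\<Phi>"
      unfolding facial_distance_def by (intro INF_greatest) (use low in simp)
    moreover have "?\<Phi> \<le> ereal (norm_setdist ?n G0 (opposite ?C G0))"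
      unfolding facial_distance_def by (rule INF_lower[OF G0])
    ultimately obtain f where f: "?\<Phi> = ereal f" "1 / ?D \<le> f"
      by (cases ?\<Phi>) auto
    have D: "0 < ?D" using Dpos[OF G0] .
    then have fpos: "0 < f" using f(2) by (meson less_le_trans zero_less_divide_1_iff)
    have "?D \<le> 1 / f"
      unfolding dual_norm_def
    proof (rule cSUP_least[OF ball])
      fix z assume z: "z \<in> {z. N z \<le> 1}"
      show "W \<bullet> z \<le> 1 / f"
      proof (cases "W \<bullet> z \<le> 0")
        case True
        then show ?thesis using fpos by (meson order_trans zero_le_divide_1_iff less_imp_le)
      next
        case False
        then obtain G x y where G: "G \<in> faces ?F" "x \<in> G" "y \<in> opposite ?C G"
            "(W \<bullet> z) * ?n (x - y) \<le> 1"
          using product_near_pair[of z] z by auto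
        have "?\<Phi> \<le> ereal (norm_setdist ?n G (opposite ?C G))"
          unfolding facial_distance_def by (rule INF_lower[OF proper[OF G(1,3)]])
        then have "f \<le> norm_setdist ?n G (opposite ?C G)" using f by simp
        also have "\<dots> \<le> ?n (x - y)" using norm_setdist_le[of ?n] n0 G by blast
        finally have "(W \<bullet> z) * f \<le> (W \<bullet> z) * ?n (x - y)" using False by (intro mult_left_mono) auto
        then show ?thesis using G(4) fpos by (simp add: field_simps)
      qed
    qed
    moreover have "1 / f \<le> ?D" using f(2) D fpos by (simp add: field_simps)
    ultimately show ?thesis using f(1) fpos by (simp add: one_ereal_def)
  qed
qed

end

theorem theorem3p1:
  fixes n :: "'k::finite \<Rightarrow> nat"
    and b :: "'n::finite \<Rightarrow> 'k"
    and p :: "'k \<Rightarrow> real^'n \<Rightarrow> real"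
    and N :: "real^'k \<Rightarrow> real"
    and C F :: "'k \<Rightarrow> (real^'n) set"
  assumes "\<And>i. 0 < n i"
    and "\<And>i. card {j. b j = i} = n i"
    and "\<And>i. norm_on (factor b i) (p i)"
    and "norm_on UNIV N"
    and "\<And>i. C i \<subseteq> factor b i"
    and "\<And>i. polytope (C i)"
    and "\<And>i. F i \<in> faces (C i)"
    and "reasonable N"
  shows "1 / facial_distance (product_norm b N p) (factor_product b F) (factor_product b C) =
    ereal (dual_norm N (\<chi> i. real_of_ereal (1 / facial_distance (p i) (F i) (C i))))"
  using reciprocal_facial_distance_product[OF assms(3,4,8,5,6,7)]
  unfolding reciprocal_facial_distance_def .

end
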